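(* Let $\nu=\nu^i_{(\mu,m,\sigma^2)}$ belong to $\mathcal F^i$. 1. Let $\psi(\nu)(dx')=\int_{\mathbb R}\nu(dx)P(x,dx')$ with $P(x,dx')=\mathcal N(ax,\beta^2)$. Then $$\psi(\nu)=\sum_{k=0}^{i}\bar\alpha_k^{(i)}\,\nu^k_{(\bar\mu,\bar m,\bar\sigma^2)},$$ with $$\bar m=am,\qquad \bar\sigma^2=\beta^2+a^2\sigma^2,\qquad \bar\mu=\frac{m\beta^2+\mu\bar\sigma^2}{a\sigma^2},$$ and, for $k=0,\dots,i$, $$\bar\alpha_k^{(i)}=\binom{i}{k}\frac{\beta^{2(i-k)}}{B_i}\sum_{j=0}^{k}\binom{k}{j}\frac{(\mu+m)^{2j}}{C_{2j}\,\sigma^{2j}}\;\frac{a^{2(k-j)}\sigma^{2(k-j)}}{\bar\sigma^{2(i-j)}},\qquad B_i=\sum_{k=0}^{i}\binom{i}{k}\frac{(\mu+m)^{2k}}{C_{2k}\,\sigma^{2k}}$$ ($\sum_{k=0}^i\bar\alpha_k^{(i)}=1$). Hence Condition (C2-f) holds with $\tau(\mu,m,\sigma^2)=(\bar\mu,\bar m,\bar\sigma^2)$ and $\alpha_k^{(i,\mu,m,\sigma^2)}=\bar\alpha_k^{(i)}$ for $k=0,\dots,i$, and the length of the mixture parameter of $\psi(\nu)$ for $\nu\in\mathcal F^i$ is $L(i)=i$. 2. Let $f_x(y)$ be the density at $y$ of $\mathcal N(hx,\gamma^2)$ and $p_\nu(y)=\int_{\mathbb R}\nu(dx)f_x(y)$.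 The marginal distribution $p_\nu(y)\,dy$ is given by the same formula as that for $\psi(\nu)$ in part 1, with $(a,\beta^2)$ everywhere replaced by $(h,\gamma^2)$.
   Context: The setting is the one-dimensional linear model with signal $x_n=ax_{n-1}+\beta\eta_n$ and observation $y_n=hx_n+\gamma w_n$, where $a,h,\beta,\gamma$ are constants with $\beta>0$, $\gamma>0$, $(\eta_n)$ and $(w_n)$ are standard one-dimensional Gaussian white noises, and the sequences $(x_n)$ and $(w_n)$ are independent. So the signal's transition operator is $P(x,dx')=\mathcal N(ax,\beta^2)$ and the conditional law of $y_n$ given $x_n=x$ is $\mathcal N(hx,\gamma^2)$. Let $X$ be a standard Gaussian random variable and $C_{2i}=\mathbb E(X^{2i})=\frac{(2i)!}{2^i i!}$ (so $C_0=1$). For $i=0$, $\nu^0_{(0,m,\sigma^2)}=\mathcal N(m,\sigma^2)$, and $\mathcal F^0$ is the class of Gaussian distributions $\mathcal N(m,\sigma^2)$, $m\in\mathbb R$, $\sigma^2>0$ (for $i=0$ one takes $\mu=0$; $\nu^0_{(\mu,m,\sigma^2)}$ is understood as $\mathcal N(m,\sigma^2)$ whatever $\mu$). For $i\ge 1$, $\mu,m\in\mathbb R$, $\sigma^2>0$, $$\nu^i_{(\mu,m,\sigma^2)}(dx)=\frac{(x+\mu)^{2i}}{C_{2i}(m+\mu;\sigma^2)}\,\mathcal N(m,\sigma^2)(dx),\qquad C_{2i}(m+\mu;\sigma^2)=\mathbb E\big((\sigma X+\mu+m)^{2i}\big),$$ and $\mathcal F^i=\{\nu^i_{(\mu,m,\sigma^2)}:(\mu,m,\sigma^2)\in\mathbb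 R\times\mathbb R\times(0,+\infty)\}$. Powers such as $\sigma^{2j}$, $\bar\sigma^{2j}$, $\beta^{2j}$ denote $(\sigma^2)^j$, $(\bar\sigma^2)^j$, $(\beta^2)^j$. Condition (C2-f), for a class $\{\nu_\theta^i: i\in\mathbb N,\theta\in\Theta\}$ (here $\theta=(\mu,m,\sigma^2)$): for all $(i,\theta)$, $\psi(\nu_\theta^i)=\sum_{k\ge 0}\alpha_k^{(i,\theta)}\nu_{\tau(\theta)}^k$, where $\tau(\theta)\in\Theta$, $\alpha_k^{(i,\theta)}\ge 0$, $\sum_k\alpha_k^{(i,\theta)}=1$, $\theta\mapsto(\tau(\theta),\alpha^{(i,\theta)})$ is measurable, and the length $\sup\{k:\alpha_k^{(i,\theta)}>0\}$ of the mixture parameter equals $L(i)<\infty$ with $i\mapsto L(i)$ non-decreasing. *)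

theory Defs
  imports "HOL-Probability.Probability"
begin

text \<open>The second argument is the variance, not the standard deviation.\<close>

definition gaussian :: "real \<Rightarrow> real \<Rightarrow> real measure" where
  "gaussian m v = density lborel (\<lambda>x. ennreal (normal_density m (sqrt v) x))"

text \<open>
  With \<open>X\<close> standard Gaussian, \<open>even_moment i\<close> is \<open>C\<^sub>2\<^sub>i = E (X\<^sup>2\<^sup>i)\<close> and
  \<open>shifted_even_moment i c v\<close> is \<open>C\<^sub>2\<^sub>i(c; \<sigma>\<^sup>2) = E ((\<sigma> X + c)\<^sup>2\<^sup>i)\<close> for \<open>v = \<sigma>\<^sup>2\<close>.
\<close>

definition even_moment :: "nat \<Rightarrow> real" where
  "even_moment i = (\<integral>x. x ^ (2 * i) \<partial>gaussian 0 1)"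

definition shifted_even_moment :: "nat \<Rightarrow> real \<Rightarrow> real \<Rightarrow> real" where
  "shifted_even_moment i c v = (\<integral>x. (sqrt v * x + c) ^ (2 * i) \<partial>gaussian 0 1)"

lemma even_moment_eq: "even_moment i = fact (2 * i) / (2 ^ i * fact i)"
  unfolding even_moment_def gaussian_def
  using has_bochner_integral_integral_eq[OF std_normal_moment_even[of i]]
  by (subst integral_density) auto

text \<open>
  Parameters are triples \<open>(\<mu>, m, v)\<close> with \<open>v = \<sigma>\<^sup>2\<close>; every power \<open>\<sigma>\<^sup>2\<^sup>j\<close> is written \<open>v ^ j\<close>.
\<close>

type_synonym param = "real \<times> real \<times> real"

definition param_space :: "param measure" where
  "param_space = restrict_space borel {(\<mu>, m, v). v > 0}"

fun nu :: "nat \<Rightarrow> param \<Rightarrow> real measure" where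
  "nu i (\<mu>, m, v) =
     (if i = 0 then gaussian m v
      else density (gaussian m v)
             (\<lambda>x. ennreal ((x + \<mu>) ^ (2 * i) / shifted_even_moment i (m + \<mu>) v)))"

definition psi :: "real \<Rightarrow> real \<Rightarrow> real measure \<Rightarrow> real measure" where
  "psi a \<beta> M = M \<bind> (\<lambda>x. gaussian (a * x) (\<beta>\<^sup>2))"

definition marginal_density :: "real \<Rightarrow> real \<Rightarrow> real measure \<Rightarrow> real \<Rightarrow> real" where
  "marginal_density h \<gamma> M y = (\<integral>x. normal_density (h * x) \<gamma> y \<partial>M)"

definition marginal :: "real \<Rightarrow> real \<Rightarrow> real measure \<Rightarrow> real measure" where
  "marginal h \<gamma> M = density lborel (\<lambda>y. ennreal (marginal_density h \<gamma> M y))"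

text \<open>
  The measure \<open>\<Sum>k\<in>K. \<alpha> k \<cdot> N k\<close> on the real line, with \<open>K\<close> finite or infinite. The weights are
  meant to be nonnegative, since \<^const>\<open>ennreal\<close> truncates negative numbers to \<open>0\<close>.
\<close>

definition mixture :: "nat set \<Rightarrow> (nat \<Rightarrow> real) \<Rightarrow> (nat \<Rightarrow> real measure) \<Rightarrow> real measure" where
  "mixture K \<alpha> N =
     measure_of UNIV (sets borel) (\<lambda>A. \<Sum>\<^sub>\<infinity>k\<in>K. ennreal (\<alpha> k) * emeasure (N k) A)"

text \<open>
  Condition (C2-f) for the class \<open>N i \<theta>\<close>, where \<open>\<theta>\<close> ranges over the measurable space \<open>T\<close>. Taking
  the supremum in \<^typ>\<open>enat\<close> makes the length equation assert finiteness of the length as well.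
\<close>

definition cond_C2f ::
  "(real measure \<Rightarrow> real measure) \<Rightarrow> 'p measure \<Rightarrow> (nat \<Rightarrow> 'p \<Rightarrow> real measure) \<Rightarrow>
   ('p \<Rightarrow> 'p) \<Rightarrow> (nat \<Rightarrow> 'p \<Rightarrow> nat \<Rightarrow> real) \<Rightarrow> (nat \<Rightarrow> nat) \<Rightarrow> bool" where
  "cond_C2f \<psi> T N \<tau> \<alpha> L \<longleftrightarrow>
     (\<forall>i. \<forall>\<theta>\<in>space T.
        \<psi> (N i \<theta>) = mixture UNIV (\<alpha> i \<theta>) (\<lambda>k. N k (\<tau> \<theta>)) \<and>
        \<tau> \<theta> \<in> space T \<and>
        (\<forall>k. \<alpha> i \<theta> k \<ge> 0) \<and>
        \<alpha> i \<theta> sums 1 \<and>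
        (SUP k\<in>{k. \<alpha> i \<theta> k > 0}. enat k) = enat (L i)) \<and>
     (\<forall>i. (\<lambda>\<theta>. (\<tau> \<theta>, \<alpha> i \<theta>)) \<in> T \<rightarrow>\<^sub>M T \<Otimes>\<^sub>M (\<Pi>\<^sub>M k\<in>UNIV. borel)) \<and>
     mono L"

text \<open>
  The updated parameter and the mixture weights for the pair \<open>(a, b)\<close>, where \<open>b\<close> is the noise
  variance \<open>\<beta>\<^sup>2\<close>. The first component of \<open>tau\<close> is meaningful only for \<open>a \<noteq> 0\<close>.
\<close>

fun tau :: "real \<Rightarrow> real \<Rightarrow> param \<Rightarrow> param" where
  "tau a b (\<mu>, m, v) = ((m * b + \<mu> * (b + a\<^sup>2 * v)) / (a * v), a * m, b + a\<^sup>2 * v)"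

fun B_const :: "nat \<Rightarrow> param \<Rightarrow> real" where
  "B_const i (\<mu>, m, v) =
     (\<Sum>k=0..i. real (i choose k) * ((\<mu> + m) ^ (2 * k) / (even_moment k * v ^ k)))"

fun alpha_bar :: "real \<Rightarrow> real \<Rightarrow> nat \<Rightarrow> param \<Rightarrow> nat \<Rightarrow> real" where
  "alpha_bar a b i (\<mu>, m, v) k =
     real (i choose k) * (b ^ (i - k) / B_const i (\<mu>, m, v)) *
     (\<Sum>j=0..k. real (k choose j) * ((\<mu> + m) ^ (2 * j) / (even_moment j * v ^ j)) *
        (a ^ (2 * (k - j)) * v ^ (k - j) / (b + a\<^sup>2 * v) ^ (i - j)))"

end

theory Submission
  imports Defs
begin

text \<open>
  With \<open>V = b + a\<^sup>2v\<close>, the joint Gaussian density of \<open>(x, y)\<close> is \<open>N(am, V)(y)\<close> times the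
  posterior \<open>N(m + av(y - am)/V, vb/V)(x)\<close>. Integrating \<open>(x + \<mu>)\<^sup>2\<^sup>i\<close> against the posterior gives its
  shifted even moment about the point \<open>-\<mu>\<close>. The posterior mean plus \<open>\<mu>\<close> equals
  \<open>(av/V)(y + \<mu>')\<close>, where \<open>\<mu>'\<close> is the updated shift, so expanding the moment in even powers of
  the mean yields the mixture; the weights come from the identity
  \<open>(2i choose 2k) C\<^sub>2\<^sub>(\<^sub>i\<^sub>-\<^sub>k\<^sub>) C\<^sub>2\<^sub>k = (i choose k) C\<^sub>2\<^sub>i\<close>. The weights sum to \<open>1\<close> because all measures
  involved are probability measures.
\<close>

declare B_const.simps [simp del] alpha_bar.simps [simp del] nu.simps [simp del]

section \<open>Even moments of Gaussian distributions\<close>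

lemma even_moment_pos: "even_moment i > 0"
  by (simp add: even_moment_eq)

text \<open>In the closed form of the moments, \<open>fact (2 * (i - k))\<close> cancels against the
  binomial coefficient and the powers of two recombine. With \<open>even_moment k\<close> in the
  denominator the identity fits the terms of the expansion below.\<close>

lemma choose_even_moment:
  assumes "k \<le> i"
  shows "real (2 * i choose (2 * k)) * even_moment (i - k) =
    real (i choose k) * even_moment i / even_moment k"
proof -
  have "(2::real) ^ i = 2 ^ (i - k) * 2 ^ k"
    using assms by (simp flip: power_add)
  then show ?thesis
    using assms
    by (simp add: even_moment_eq binomial_fact field_simps diff_mult_distrib)
qed

text \<open>Serves to discard the odd central moments in a binomial expansion. Each induction step
  adds the indices 2i+1, which contributes nothing, and 2i+2.\<close>

lemma sum_vanishing_odd: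
  fixes f :: "nat \<Rightarrow> 'a::comm_monoid_add"
  assumes "\<And>n. odd n \<Longrightarrow> f n = 0"
  shows "(\<Sum>n\<le>2 * i. f n) = (\<Sum>k\<le>i. f (2 * k))"
proof (induction i)
  case (Suc i)
  have "2 * Suc i = Suc (Suc (2 * i))" by simp
  with Suc assms show ?case by (simp del: mult_Suc_right)
qed simp

text \<open>Expanding around the mean, x + \<mu> = (m + \<mu>) + (x - m), leaves only even central
  moments, and \<open>choose_even_moment\<close> simplifies the coefficients.\<close>

lemma normal_shifted_even_moment:
  assumes "s > 0"
  shows "has_bochner_integral lborel (\<lambda>x. normal_density m s x * (x + \<mu>) ^ (2 * i))
    (even_moment i * (\<Sum>k\<le>i. real (i choose k) * (m + \<mu>) ^ (2 * k) * (s\<^sup>2) ^ (i - k) / even_moment k))"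
proof -
  \<comment> \<open>\<open>M n\<close> is the n-th central moment of the normal law with standard
    deviation \<open>s\<close>.\<close>
  define M where "M n = (if even n then s ^ n * even_moment (n div 2) else 0)" for n
  have M: "has_bochner_integral lborel (\<lambda>x. normal_density m s x * (x - m) ^ n) (M n)" for n
  proof (cases "even n")
    case True
    then obtain k where "n = 2 * k" by (elim evenE)
    moreover have "s ^ (2 * k) * even_moment k = fact (2 * k) / ((2 / s\<^sup>2) ^ k * fact k)"
      by (simp add: even_moment_eq power_divide power_mult)
    ultimately show ?thesis
      using normal_moment_even[OF assms, of m k] by (simp add: M_def)
  next
    case False
    then obtain k where "n = 2 * k + 1" by (elim oddE)
    then show ?thesis
      using normal_moment_odd[OF assms, of m k] by (simp add: M_def)
  qed
  have "has_bochner_integral lborel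
      (\<lambda>x. \<Sum>n\<le>2 * i. real (2 * i choose n) * (m + \<mu>) ^ n * (normal_density m s x * (x - m) ^ (2 * i - n)))
      (\<Sum>n\<le>2 * i. real (2 * i choose n) * (m + \<mu>) ^ n * M (2 * i - n))"
    by (intro has_bochner_integral_sum has_bochner_integral_mult_right M)
  also have "(\<lambda>x. \<Sum>n\<le>2 * i. real (2 * i choose n) * (m + \<mu>) ^ n * (normal_density m s x * (x - m) ^ (2 * i - n)))
     = (\<lambda>x. normal_density m s x * (x + \<mu>) ^ (2 * i))"
  proof
    fix x
    have "(x + \<mu>) ^ (2 * i) = ((m + \<mu>) + (x - m)) ^ (2 * i)" by (simp add: algebra_simps)
    then show "(\<Sum>n\<le>2 * i. real (2 * i choose n) * (m + \<mu>) ^ n * (normal_density m s x * (x - m) ^ (2 * i - n)))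
      = normal_density m s x * (x + \<mu>) ^ (2 * i)"
      by (simp only: binomial_ring sum_distrib_left) (simp add: mult_ac)
  qed
  also have "(\<Sum>n\<le>2 * i. real (2 * i choose n) * (m + \<mu>) ^ n * M (2 * i - n)) =
     (\<Sum>k\<le>i. real (2 * i choose (2 * k)) * (m + \<mu>) ^ (2 * k) * M (2 * i - 2 * k))"
    \<comment> \<open>For odd n beyond 2i the truncated difference is 0, where \<open>M\<close> does
      not vanish; there the binomial coefficient is zero instead.\<close>
    by (rule sum_vanishing_odd) (auto simp: M_def not_le)
  also have "\<dots> = even_moment i *
    (\<Sum>k\<le>i. real (i choose k) * (m + \<mu>) ^ (2 * k) * (s\<^sup>2) ^ (i - k) / even_moment k)"
    unfolding sum_distrib_left
  proof (rule sum.cong)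
    fix k assume "k \<in> {..i}"
    then have "real (2 * i choose (2 * k)) * (m + \<mu>) ^ (2 * k) * M (2 * i - 2 * k) =
      (m + \<mu>) ^ (2 * k) * (s\<^sup>2) ^ (i - k) * (real (2 * i choose (2 * k)) * even_moment (i - k))"
      by (simp add: M_def power_mult flip: diff_mult_distrib2)
    also have "\<dots> =
      even_moment i * (real (i choose k) * (m + \<mu>) ^ (2 * k) * (s\<^sup>2) ^ (i - k) / even_moment k)"
      using \<open>k \<in> {..i}\<close> by (simp add: choose_even_moment)
    finally show "real (2 * i choose (2 * k)) * (m + \<mu>) ^ (2 * k) * M (2 * i - 2 * k) =
      even_moment i * (real (i choose k) * (m + \<mu>) ^ (2 * k) * (s\<^sup>2) ^ (i - k) / even_moment k)" .
  qed simp
  finally show ?thesis .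
qed

text \<open>Factoring \<open>sqrt v\<close> out of the base reduces the claim to the standard normal
  density with shift \<open>c / sqrt v\<close>.\<close>

lemma shifted_even_moment_eq:
  assumes "v > 0"
  shows "shifted_even_moment i c v =
    even_moment i * (\<Sum>k\<le>i. real (i choose k) * c ^ (2 * k) * v ^ (i - k) / even_moment k)"
proof -
  have "shifted_even_moment i c v =
    (\<integral>x. v ^ i * (std_normal_density x * (x + c / sqrt v) ^ (2 * i)) \<partial>lborel)"
    unfolding shifted_even_moment_def gaussian_def
  proof (subst integral_density, goal_cases)
    \<comment> \<open>The first three goals are the side conditions of
      \<open>integral_density\<close>.\<close>
    case 4
    have "(sqrt v * x + c) ^ (2 * i) = v ^ i * (x + c / sqrt v) ^ (2 * i)" for x
    proof -
      have "sqrt v * x + c = sqrt v * (x + c / sqrt v)"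
        using assms by (simp add: field_simps)
      then show ?thesis
        using assms by (simp only: power_mult_distrib) (simp add: power_mult)
    qed
    then show ?case by (simp add: mult_ac)
  qed auto
  also have "\<dots> = v ^ i * (even_moment i *
     (\<Sum>k\<le>i. real (i choose k) * (c / sqrt v) ^ (2 * k) / even_moment k))"
    using has_bochner_integral_integral_eq[OF normal_shifted_even_moment[of 1 0 "c / sqrt v" i]]
    by simp
  also have "\<dots> = even_moment i *
     (\<Sum>k\<le>i. real (i choose k) * c ^ (2 * k) * v ^ (i - k) / even_moment k)"
    unfolding sum_distrib_left
  proof (rule sum.cong)
    fix k assume "k \<in> {..i}"
    then have "v ^ i = v ^ (i - k) * v ^ k" by (simp flip: power_add)
    then show "v ^ i * (even_moment i * (real (i choose k) * (c / sqrt v) ^ (2 * k) / even_moment k)) =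
      even_moment i * (real (i choose k) * c ^ (2 * k) * v ^ (i - k) / even_moment k)"
      using assms by (simp add: power_divide power_mult[of "sqrt v"])
  qed simp
  finally show ?thesis .
qed

text \<open>The substitution x = m + sqrt v * z is bypassed: the closed forms of the two integrals
  coincide.\<close>

lemma normal_shifted_moment:
  assumes "v > 0"
  shows "has_bochner_integral lborel (\<lambda>x. normal_density m (sqrt v) x * (x + \<mu>) ^ (2 * i))
    (shifted_even_moment i (m + \<mu>) v)"
  using normal_shifted_even_moment[of "sqrt v" m \<mu> i] assms by (simp add: shifted_even_moment_eq)

text \<open>The summand at k = 0 equals 1 and the others are nonnegative.\<close>

lemma B_const_pos:
  assumes "v > 0"
  shows "B_const i (\<mu>, m, v) > 0"
proof -
  have "(\<Sum>k\<in>{0}. real (i choose k) * ((\<mu> + m) ^ (2 * k) / (even_moment k * v ^ k)))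
    \<le> B_const i (\<mu>, m, v)"
    unfolding B_const.simps using assms
    by (intro sum_mono2) (auto simp: even_moment_pos less_imp_le)
  then show ?thesis using even_moment_pos[of 0] by (auto intro: less_le_trans[rotated])
qed

text \<open>Identifies \<open>B_const\<close> as the normaliser of \<open>nu\<close> stripped of a
  factor independent of the mean and the shift.\<close>

lemma shifted_even_moment_B_const:
  assumes "v > 0"
  shows "shifted_even_moment i (m + \<mu>) v = even_moment i * v ^ i * B_const i (\<mu>, m, v)"
proof -
  have "(\<Sum>k\<le>i. real (i choose k) * (m + \<mu>) ^ (2 * k) * v ^ (i - k) / even_moment k) =
    v ^ i * B_const i (\<mu>, m, v)"
    unfolding B_const.simps sum_distrib_left atLeast0AtMost
  proof (rule sum.cong)
    fix k assume "k \<in> {..i}"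
    then have "v ^ i = v ^ (i - k) * v ^ k" by (simp flip: power_add)
    then show "real (i choose k) * (m + \<mu>) ^ (2 * k) * v ^ (i - k) / even_moment k =
      v ^ i * (real (i choose k) * ((\<mu> + m) ^ (2 * k) / (even_moment k * v ^ k)))"
      using assms by (simp add: add.commute)
  qed simp
  then show ?thesis using assms by (simp add: shifted_even_moment_eq)
qed

lemma shifted_even_moment_pos:
  assumes "v > 0"
  shows "shifted_even_moment i c v > 0"
  using shifted_even_moment_B_const[OF assms, of i c 0] B_const_pos[OF assms] even_moment_pos assms
  by simp

section \<open>Lebesgue densities of the class\<close>

text \<open>No case split on \<open>i\<close>: at \<open>i = 0\<close> the polynomial factor and its
  normaliser are both 1, so the plain Gaussian is covered as well.\<close>

fun nu_density :: "nat \<Rightarrow> param \<Rightarrow> real \<Rightarrow> real" where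
  "nu_density i (\<mu>, m, v) x =
     normal_density m (sqrt v) x * (x + \<mu>) ^ (2 * i) / shifted_even_moment i (m + \<mu>) v"

lemma nu_density_measurable [measurable]: "nu_density i \<theta> \<in> borel_measurable borel"
  by (cases \<theta>) (simp add: fun_eq_iff cong: measurable_cong)

lemma nu_density_nonneg:
  assumes "v > 0"
  shows "nu_density i (\<mu>, m, v) x \<ge> 0"
  using shifted_even_moment_pos[OF assms, of i "m + \<mu>"] by simp

lemma nu_eq_density:
  assumes "v > 0"
  shows "nu i (\<mu>, m, v) = density lborel (\<lambda>x. ennreal (nu_density i (\<mu>, m, v) x))"
proof (cases "i = 0")
  case True
  then show ?thesis
    using shifted_even_moment_eq[OF assms, of 0] by (simp add: nu.simps gaussian_def even_moment_eq)
next
  case False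
  then show ?thesis
    using shifted_even_moment_pos[OF assms, of i "m + \<mu>"]
    by (simp add: nu.simps gaussian_def density_density_eq flip: ennreal_mult')
qed

lemma prob_space_nu:
  assumes "v > 0"
  shows "prob_space (nu i (\<mu>, m, v))"
proof
  \<comment> \<open>The value 1 is written as a quotient so that the rule for division by a constant
    applies.\<close>
  have "has_bochner_integral lborel (nu_density i (\<mu>, m, v))
    (shifted_even_moment i (m + \<mu>) v / shifted_even_moment i (m + \<mu>) v)"
    unfolding nu_density.simps[abs_def]
    by (intro has_bochner_integral_divide normal_shifted_moment assms)
  then have "(\<integral>\<^sup>+x. ennreal (nu_density i (\<mu>, m, v) x) \<partial>lborel) = 1"
    using shifted_even_moment_pos[OF assms, of i "m + \<mu>"] nu_density_nonneg[OF assms]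
    by (subst nn_integral_eq_integral) (auto simp: has_bochner_integral_iff simp del: nu_density.simps)
  then show "emeasure (nu i (\<mu>, m, v)) (space (nu i (\<mu>, m, v))) = 1"
    using nu_eq_density[OF assms, of i \<mu> m]
    by (simp add: emeasure_density del: nu_density.simps)
qed

section \<open>Convolution with a Gaussian through the posterior\<close>

text \<open>Bayes' rule: the second factor on the right is the posterior of \<open>x\<close> given \<open>y\<close>.\<close>

lemma normal_density_bayes:
  fixes a :: real
  assumes "v > 0" "\<beta> > 0"
  defines "V \<equiv> \<beta>\<^sup>2 + a\<^sup>2 * v"
  shows "normal_density m (sqrt v) x * normal_density (a * x) \<beta> y =
    normal_density (a * m) (sqrt V) y *
    normal_density (m + a * v * (y - a * m) / V) (sqrt (v * \<beta>\<^sup>2 / V)) x"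
proof -
  have V: "V > 0" unfolding V_def using assms by (simp add: add_pos_nonneg)
  \<comment> \<open>Completing the square in x: over the common denominator
    \<open>2 * V * v * \<beta>\<^sup>2\<close> both exponents have the same numerator, a polynomial
    identity once \<open>V\<close> is unfolded.\<close>
  have "- (x - m)\<^sup>2 / (2 * v) + - (y - a * x)\<^sup>2 / (2 * \<beta>\<^sup>2) =
    - (y - a * m)\<^sup>2 / (2 * V) + - (x - (m + a * v * (y - a * m) / V))\<^sup>2 / (2 * (v * \<beta>\<^sup>2 / V))"
  proof -
    have "x - (m + a * v * (y - a * m) / V) = (V * (x - m) - a * v * (y - a * m)) / V"
      using V by (simp add: field_simps)
    then have "(x - (m + a * v * (y - a * m) / V))\<^sup>2 / (2 * (v * \<beta>\<^sup>2 / V)) =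
      (V * (x - m) - a * v * (y - a * m))\<^sup>2 / (2 * V * v * \<beta>\<^sup>2)"
      using V by (simp add: power_divide power2_eq_square)
    moreover have "- (x - m)\<^sup>2 / (2 * v) + - (y - a * x)\<^sup>2 / (2 * \<beta>\<^sup>2) =
      - (V * \<beta>\<^sup>2 * (x - m)\<^sup>2 + V * v * (y - a * x)\<^sup>2) / (2 * V * v * \<beta>\<^sup>2)"
      using V assms(1,2) by (simp add: field_simps power2_eq_square)
    moreover have "V * \<beta>\<^sup>2 * (x - m)\<^sup>2 + V * v * (y - a * x)\<^sup>2 =
      v * \<beta>\<^sup>2 * (y - a * m)\<^sup>2 + (V * (x - m) - a * v * (y - a * m))\<^sup>2"
      unfolding V_def by algebra
    \<comment> \<open>A generic \<open>P\<close> stands for the completed square, which therefore is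
      not expanded.\<close>
    moreover have "- (y - a * m)\<^sup>2 / (2 * V) + - (P\<^sup>2 / (2 * V * v * \<beta>\<^sup>2)) =
      - (v * \<beta>\<^sup>2 * (y - a * m)\<^sup>2 + P\<^sup>2) / (2 * V * v * \<beta>\<^sup>2)" for P
      using V assms(1,2) by (simp add: field_simps power2_eq_square)
    ultimately show ?thesis
      by (simp only: minus_divide_left[symmetric])
  qed
  then have exps: "exp (- (x - m)\<^sup>2 / (2 * v)) * exp (- (y - a * x)\<^sup>2 / (2 * \<beta>\<^sup>2)) =
    exp (- (y - a * m)\<^sup>2 / (2 * V)) *
    exp (- (x - (m + a * v * (y - a * m) / V))\<^sup>2 / (2 * (v * \<beta>\<^sup>2 / V)))"
    by (simp only: exp_add[symmetric])
  \<comment> \<open>The normalising constants agree because the products of the two variances on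
    either side are equal.\<close>
  have sqrts: "sqrt (2 * pi * v) * sqrt (2 * pi * \<beta>\<^sup>2) =
     sqrt (2 * pi * V) * sqrt (2 * pi * (v * \<beta>\<^sup>2 / V))"
    using V by (simp flip: real_sqrt_mult)
  have normal: "normal_density c (sqrt u) z = exp (- (z - c)\<^sup>2 / (2 * u)) / sqrt (2 * pi * u)"
    if "u > 0" for c u z
    using that by (simp add: normal_density_def)
  have "v * \<beta>\<^sup>2 / V > 0" using V assms(1,2) by simp
  moreover have "normal_density (a * x) \<beta> y = exp (- (y - a * x)\<^sup>2 / (2 * \<beta>\<^sup>2)) / sqrt (2 * pi * \<beta>\<^sup>2)"
    by (simp add: normal_density_def)
  ultimately show ?thesis
    using V assms(1) by (simp only: normal times_divide_times_eq exps sqrts)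
qed

text \<open>By Bayes' rule the marginal factor in y leaves the integral, and what remains is a
  moment of the posterior. The updated shift, which divides by \<open>a\<close>, enters only
  later.\<close>

lemma nu_density_conv:
  fixes a :: real
  assumes "v > 0" "\<beta> > 0"
  defines "V \<equiv> \<beta>\<^sup>2 + a\<^sup>2 * v"
  shows "has_bochner_integral lborel (\<lambda>x. nu_density i (\<mu>, m, v) x * normal_density (a * x) \<beta> y)
    (normal_density (a * m) (sqrt V) y *
      shifted_even_moment i (m + a * v * (y - a * m) / V + \<mu>) (v * \<beta>\<^sup>2 / V) /
      shifted_even_moment i (m + \<mu>) v)"
proof -
  have V: "V > 0" unfolding V_def using assms by (simp add: add_pos_nonneg)
  let ?n = "normal_density (m + a * v * (y - a * m) / V) (sqrt (v * \<beta>\<^sup>2 / V))"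
  have "has_bochner_integral lborel (\<lambda>x. ?n x * (x + \<mu>) ^ (2 * i))
    (shifted_even_moment i (m + a * v * (y - a * m) / V + \<mu>) (v * \<beta>\<^sup>2 / V))"
    by (rule normal_shifted_moment) (use V assms in simp)
  then have "has_bochner_integral lborel
    (\<lambda>x. normal_density (a * m) (sqrt V) y / shifted_even_moment i (m + \<mu>) v * (?n x * (x + \<mu>) ^ (2 * i)))
    (normal_density (a * m) (sqrt V) y / shifted_even_moment i (m + \<mu>) v *
      shifted_even_moment i (m + a * v * (y - a * m) / V + \<mu>) (v * \<beta>\<^sup>2 / V))"
    by (rule has_bochner_integral_mult_right)
  also have "(\<lambda>x. normal_density (a * m) (sqrt V) y / shifted_even_moment i (m + \<mu>) v * (?n x * (x + \<mu>) ^ (2 * i))) =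
    (\<lambda>x. nu_density i (\<mu>, m, v) x * normal_density (a * x) \<beta> y)"
  proof
    fix x
    show "normal_density (a * m) (sqrt V) y / shifted_even_moment i (m + \<mu>) v * (?n x * (x + \<mu>) ^ (2 * i)) =
      nu_density i (\<mu>, m, v) x * normal_density (a * x) \<beta> y"
      using normal_density_bayes[OF assms(1,2), of m x a y] unfolding V_def
      by (simp add: field_simps)
  qed
  finally show ?thesis by simp
qed


section \<open>The mixture weights\<close>

text \<open>The shifted moment on the right is the normaliser of \<open>nu k\<close> at the updated
  parameter, so it cancels when the weight multiplies the density of that component. The inner sum
  of the weight is matched term by term with the expansion of this moment.\<close>

lemma alpha_bar_eq:
  fixes a b :: real
  assumes "v > 0" "b > 0" "a \<noteq> 0" "k \<le> i"
  defines "V \<equiv> b + a\<^sup>2 * v"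
  shows "alpha_bar a b i (\<mu>, m, v) k =
    real (i choose k) * (a * v / V) ^ (2 * k) * (v * b / V) ^ (i - k) *
    shifted_even_moment k (V * (m + \<mu>) / (a * v)) V / (even_moment k * v ^ i * B_const i (\<mu>, m, v))"
proof -
  have V: "V > 0" unfolding V_def using assms by (simp add: add_pos_nonneg)
  let ?L = "\<lambda>j. real (k choose j) * ((\<mu> + m) ^ (2 * j) / (even_moment j * v ^ j)) *
        (a ^ (2 * (k - j)) * v ^ (k - j) / V ^ (i - j))"
  let ?R = "\<lambda>j. real (k choose j) * (V * (m + \<mu>) / (a * v)) ^ (2 * j) * V ^ (k - j) / even_moment j"
  have "b ^ (i - k) * ?L j = (a * v / V) ^ (2 * k) * (v * b / V) ^ (i - k) / v ^ i * ?R j" if jk: "j \<le> k" for j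
  proof -
    \<comment> \<open>Here p = k - j and q = i - k, which removes every truncated
      subtraction.\<close>
    obtain p where p: "k = j + p" using le_Suc_ex[OF jk] by blast
    obtain q where q: "i = j + p + q" using le_Suc_ex[OF assms(4)] p by blast
    \<comment> \<open>\<open>x\<close> is the factor relating the posterior mean to y. Of
      \<open>x ^ (2 * k)\<close>, the part with exponent 2j cancels against the shift, and the part
      with exponent 2p combines with \<open>V ^ p\<close>.\<close>
    define x where "x = a * v / V"
    have x: "x \<noteq> 0" "V * (m + \<mu>) / (a * v) = (\<mu> + m) / x"
      using V assms(1-3) by (simp_all add: x_def add.commute)
    have even_part: "x ^ (2 * j) * ((\<mu> + m) / x) ^ (2 * j) = (\<mu> + m) ^ (2 * j)"
      using x(1) by (simp add: power_divide)
    have "x\<^sup>2 * V = a\<^sup>2 * v * v / V"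
      using V by (simp add: x_def power2_eq_square)
    then have "(x\<^sup>2 * V) ^ p = (a\<^sup>2 * v * v / V) ^ p" by simp
    then have rest: "x ^ (2 * p) * V ^ p = a ^ (2 * p) * v ^ p * v ^ p / V ^ p"
      by (simp only: power_mult power_mult_distrib power_divide)
    have "x ^ (2 * k) * (v * b / V) ^ (i - k) / v ^ i *
        (real (k choose j) * ((\<mu> + m) / x) ^ (2 * j) * V ^ (k - j) / even_moment j) =
      (x ^ (2 * j) * ((\<mu> + m) / x) ^ (2 * j)) * (x ^ (2 * p) * V ^ p) *
        (real (k choose j) * (v * b / V) ^ q / (v ^ i * even_moment j))"
      by (simp add: p q distrib_left power_add mult_ac)
    also have "\<dots> = b ^ (i - k) * ?L j"
      unfolding even_part rest
      using V assms(1) by (simp add: p q power_add power_mult_distrib power_divide mult_ac)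
    finally show ?thesis unfolding x(2) x_def by simp
  qed
  then have "b ^ (i - k) * (\<Sum>j\<le>k. ?L j) =
      (a * v / V) ^ (2 * k) * (v * b / V) ^ (i - k) / v ^ i * (\<Sum>j\<le>k. ?R j)"
    unfolding sum_distrib_left by (intro sum.cong) auto
  moreover have "(\<Sum>j\<le>k. ?R j) = shifted_even_moment k (V * (m + \<mu>) / (a * v)) V / even_moment k"
    using even_moment_pos[of k] by (simp add: shifted_even_moment_eq[OF V])
  moreover have "alpha_bar a b i (\<mu>, m, v) k =
    real (i choose k) * (b ^ (i - k) * (\<Sum>j\<le>k. ?L j)) / B_const i (\<mu>, m, v)"
    by (simp add: alpha_bar.simps V_def atLeast0AtMost)
  ultimately show ?thesis by (simp add: mult_ac)
qed

lemma nu_density_conv_mixture: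
  fixes a :: real
  assumes "v > 0" "\<beta> > 0" "a \<noteq> 0 \<or> i = 0"
  shows "has_bochner_integral lborel (\<lambda>x. nu_density i (\<mu>, m, v) x * normal_density (a * x) \<beta> y)
    (\<Sum>k\<le>i. alpha_bar a (\<beta>\<^sup>2) i (\<mu>, m, v) k * nu_density k (tau a (\<beta>\<^sup>2) (\<mu>, m, v)) y)"
proof -
  define V where "V = \<beta>\<^sup>2 + a\<^sup>2 * v"
  have V: "V > 0" unfolding V_def using assms by (simp add: add_pos_nonneg)
  have "normal_density (a * m) (sqrt V) y *
      shifted_even_moment i (m + a * v * (y - a * m) / V + \<mu>) (v * \<beta>\<^sup>2 / V) /
      shifted_even_moment i (m + \<mu>) v =
    (\<Sum>k\<le>i. alpha_bar a (\<beta>\<^sup>2) i (\<mu>, m, v) k * nu_density k (tau a (\<beta>\<^sup>2) (\<mu>, m, v)) y)"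
  proof (cases "i = 0")
    case True
    then show ?thesis
      using V assms by (simp add: V_def[symmetric] shifted_even_moment_eq even_moment_eq
          alpha_bar.simps B_const.simps)
  next
    case False
    with assms have a: "a \<noteq> 0" by simp
    \<comment> \<open>Chosen so that the posterior mean plus \<mu>, an affine function of y,
      vanishes exactly at y = -\<mu>'.\<close>
    define \<mu>' where "\<mu>' = (m * \<beta>\<^sup>2 + \<mu> * V) / (a * v)"
    have mean: "m + a * v * (y - a * m) / V + \<mu> = a * v / V * (y + \<mu>')"
    proof -
      have "(m + \<mu>) * V + a * v * (y - a * m) = a * v * y + (m * \<beta>\<^sup>2 + \<mu> * V)"
        unfolding V_def by algebra
      then show ?thesis using V a assms by (simp add: \<mu>'_def field_simps)
    qed
    \<comment> \<open>The argument of the new normaliser, in the form that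
      \<open>alpha_bar_eq\<close> expects.\<close>
    have shift: "a * m + \<mu>' = V * (m + \<mu>) / (a * v)"
      using a assms by (simp add: \<mu>'_def V_def field_simps power2_eq_square)
    have w: "v * \<beta>\<^sup>2 / V > 0" using V assms by simp
    have "normal_density (a * m) (sqrt V) y *
        shifted_even_moment i (m + a * v * (y - a * m) / V + \<mu>) (v * \<beta>\<^sup>2 / V) /
        shifted_even_moment i (m + \<mu>) v =
      (\<Sum>k\<le>i. normal_density (a * m) (sqrt V) y *
        (real (i choose k) * (a * v / V * (y + \<mu>')) ^ (2 * k) * (v * \<beta>\<^sup>2 / V) ^ (i - k) / even_moment k) /
        (v ^ i * B_const i (\<mu>, m, v)))"
      \<comment> \<open>Numerator and denominator both carry the factor
        \<open>even_moment i\<close>, which cancels.\<close>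
      unfolding mean shifted_even_moment_eq[OF w] shifted_even_moment_B_const[OF assms(1)]
      using even_moment_pos[of i]
      by (simp add: mult.assoc sum_distrib_left sum_divide_distrib)
    also have "\<dots> = (\<Sum>k\<le>i. alpha_bar a (\<beta>\<^sup>2) i (\<mu>, m, v) k * nu_density k (tau a (\<beta>\<^sup>2) (\<mu>, m, v)) y)"
    proof (rule sum.cong)
      fix k assume k: "k \<in> {..i}"
      have tau: "tau a (\<beta>\<^sup>2) (\<mu>, m, v) = (\<mu>', a * m, V)" by (simp add: \<mu>'_def V_def)
      have alpha: "alpha_bar a (\<beta>\<^sup>2) i (\<mu>, m, v) k =
        real (i choose k) * (a * v / V) ^ (2 * k) * (v * \<beta>\<^sup>2 / V) ^ (i - k) *
        shifted_even_moment k (a * m + \<mu>') V / (even_moment k * v ^ i * B_const i (\<mu>, m, v))"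
        unfolding shift V_def by (rule alpha_bar_eq) (use k a assms in auto)
      show "normal_density (a * m) (sqrt V) y *
        (real (i choose k) * (a * v / V * (y + \<mu>')) ^ (2 * k) * (v * \<beta>\<^sup>2 / V) ^ (i - k) / even_moment k) /
        (v ^ i * B_const i (\<mu>, m, v)) =
        alpha_bar a (\<beta>\<^sup>2) i (\<mu>, m, v) k * nu_density k (tau a (\<beta>\<^sup>2) (\<mu>, m, v)) y"
        unfolding tau alpha nu_density.simps power_mult_distrib
        using shifted_even_moment_pos[OF V, of k "a * m + \<mu>'"] by (simp add: mult_ac)
    qed simp
    finally show ?thesis .
  qed
  with nu_density_conv[OF assms(1,2), of i \<mu> m a y] show ?thesis
    by (simp add: V_def del: nu_density.simps tau.simps)
qed

lemma alpha_bar_nonneg: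
  assumes "v > 0" "b \<ge> 0"
  shows "alpha_bar a b i (\<mu>, m, v) k \<ge> 0"
  using assms B_const_pos[OF assms(1), of i \<mu> m] even_moment_pos
  unfolding alpha_bar.simps
  \<comment> \<open>Since \<open>a\<close> may be negative, its even powers are read as powers of
    its square.\<close>
  by (auto intro!: mult_nonneg_nonneg divide_nonneg_nonneg sum_nonneg
      simp: less_imp_le power_mult[of a])

text \<open>Makes the mixture length exactly \<open>i\<close>, not merely at most \<open>i\<close>.
  At k = i every factor in \<open>alpha_bar_eq\<close> is positive, the power of \<open>a\<close>
  being even and \<open>a\<close> nonzero.\<close>

lemma alpha_bar_self_pos:
  assumes "v > 0" "b > 0" "a \<noteq> 0"
  shows "alpha_bar a b i (\<mu>, m, v) i > 0"
proof -
  have "b + a\<^sup>2 * v > 0" using assms by (simp add: add_pos_nonneg)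
  then show ?thesis
    using assms
    by (subst alpha_bar_eq)
      (auto intro!: divide_pos_pos mult_pos_pos
        simp: power_mult[of "_ / _"] B_const_pos even_moment_pos shifted_even_moment_pos)
qed

section \<open>Mixtures of measures with densities\<close>

text \<open>Linearity of the nonnegative integral; the sign conditions let \<open>ennreal\<close>
  distribute over the sum and the products.\<close>

lemma emeasure_density_sum:
  assumes N: "\<And>k. k \<in> K \<Longrightarrow> N k = density lborel (\<lambda>x. ennreal (g k x))"
    and [measurable]: "\<And>k. k \<in> K \<Longrightarrow> g k \<in> borel_measurable borel"
    and \<alpha>: "\<And>k. k \<in> K \<Longrightarrow> \<alpha> k \<ge> 0"
    and g: "\<And>k x. k \<in> K \<Longrightarrow> g k x \<ge> 0"
    and [measurable]: "A \<in> sets borel"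
  shows "emeasure (density lborel (\<lambda>x. ennreal (\<Sum>k\<in>K. \<alpha> k * g k x))) A =
    (\<Sum>k\<in>K. ennreal (\<alpha> k) * emeasure (N k) A)"
proof -
  have "(\<Sum>k\<in>K. ennreal (\<alpha> k) * emeasure (N k) A) =
     (\<Sum>k\<in>K. \<integral>\<^sup>+x. ennreal (\<alpha> k) * (ennreal (g k x) * indicator A x) \<partial>lborel)"
    by (auto intro!: sum.cong simp: N emeasure_density nn_integral_cmult)
  also have "\<dots> = (\<integral>\<^sup>+x. (\<Sum>k\<in>K. ennreal (\<alpha> k) * (ennreal (g k x) * indicator A x)) \<partial>lborel)"
    by (rule nn_integral_sum[symmetric]) measurable
  also have "\<dots> = (\<integral>\<^sup>+x. ennreal (\<Sum>k\<in>K. \<alpha> k * g k x) * indicator A x \<partial>lborel)"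
    using \<alpha> g
    by (intro nn_integral_cong)
      (auto simp: sum_ennreal[symmetric] ennreal_mult sum_distrib_right mult.assoc intro!: sum.cong)
  finally show ?thesis by (simp add: emeasure_density)
qed

text \<open>\<open>measure_of\<close> returns the given set function only if it is a measure. Here
  it agrees on Borel sets with the measure of a density, which settles this.\<close>

lemma mixture_density:
  assumes "finite K"
    and N: "\<And>k. k \<in> K \<Longrightarrow> N k = density lborel (\<lambda>x. ennreal (g k x))"
      "\<And>k. k \<in> K \<Longrightarrow> g k \<in> borel_measurable borel"
      "\<And>k. k \<in> K \<Longrightarrow> \<alpha> k \<ge> 0" "\<And>k x. k \<in> K \<Longrightarrow> g k x \<ge> 0"
  shows "mixture K \<alpha> N = density lborel (\<lambda>x. ennreal (\<Sum>k\<in>K. \<alpha> k * g k x))"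
proof -
  let ?D = "density lborel (\<lambda>x. ennreal (\<Sum>k\<in>K. \<alpha> k * g k x))"
  have "(\<Sum>\<^sub>\<infinity>k\<in>K. ennreal (\<alpha> k) * emeasure (N k) A) = emeasure ?D A" if "A \<in> sets borel" for A
    using assms that by (simp add: emeasure_density_sum)
  then have "mixture K \<alpha> N = measure_of UNIV (sets borel) (emeasure ?D)"
    unfolding mixture_def
    using sets.sigma_sets_eq[of "borel :: real measure"] by (intro measure_of_eq) auto
  also have "\<dots> = ?D" using measure_of_of_measure[of ?D] by simp
  finally show ?thesis .
qed

section \<open>The Gaussian transition kernel\<close>

lemma gaussian_kernel:
  assumes "\<beta> > 0"
  shows "(\<lambda>x. gaussian (a * x) (\<beta>\<^sup>2)) \<in> borel \<rightarrow>\<^sub>M prob_algebra borel"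
proof (intro measurable_prob_algebraI measurable_subprob_algebra)
  fix x
  show "prob_space (gaussian (a * x) (\<beta>\<^sup>2))"
    using prob_space_normal_density[of \<beta> "a * x"] assms by (simp add: gaussian_def)
  then show "subprob_space (gaussian (a * x) (\<beta>\<^sup>2))" by (rule prob_space_imp_subprob_space)
  show "sets (gaussian (a * x) (\<beta>\<^sup>2)) = sets borel" by (simp add: gaussian_def)
next
  fix A :: "real set" assume [measurable]: "A \<in> sets borel"
  \<comment> \<open>The density is jointly measurable in the kernel argument and the point, so its
    integral over \<open>A\<close> is measurable in the argument.\<close>
  show "(\<lambda>x. emeasure (gaussian (a * x) (\<beta>\<^sup>2)) A) \<in> borel_measurable borel"
    by (simp add: gaussian_def emeasure_density normal_density_def)
qed

text \<open>On a Borel set the bind is an iterated integral over x and then y; Tonelli's theorem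
  exchanges the order.\<close>

lemma psi_density:
  assumes "\<beta> > 0" and f[measurable]: "f \<in> borel_measurable borel"
  shows "psi a \<beta> (density lborel f) =
    density lborel (\<lambda>y. \<integral>\<^sup>+x. f x * ennreal (normal_density (a * x) \<beta> y) \<partial>lborel)"
proof (rule measure_eqI)
  have ker: "(\<lambda>x. gaussian (a * x) (\<beta>\<^sup>2)) \<in> density lborel f \<rightarrow>\<^sub>M subprob_algebra borel"
    using measurable_prob_algebraD[OF gaussian_kernel[OF assms(1), of a]] by simp
  show sets: "sets (psi a \<beta> (density lborel f)) =
    sets (density lborel (\<lambda>y. \<integral>\<^sup>+x. f x * ennreal (normal_density (a * x) \<beta> y) \<partial>lborel))"
    unfolding psi_def by (subst sets_bind[where N = borel]) (auto simp: gaussian_def)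
  fix A assume "A \<in> sets (psi a \<beta> (density lborel f))"
  then have [measurable]: "A \<in> sets borel" using sets by simp
  have [measurable]: "(\<lambda>(x, y). normal_density (a * x) \<beta> y) \<in> borel_measurable (borel \<Otimes>\<^sub>M borel)"
    by (simp add: normal_density_def)
  have "emeasure (psi a \<beta> (density lborel f)) A =
    (\<integral>\<^sup>+x. emeasure (gaussian (a * x) (\<beta>\<^sup>2)) A \<partial>density lborel f)"
    unfolding psi_def by (rule emeasure_bind[OF _ ker]) auto
  also have "\<dots> = (\<integral>\<^sup>+x. f x * (\<integral>\<^sup>+y. ennreal (normal_density (a * x) \<beta> y) * indicator A y \<partial>lborel) \<partial>lborel)"
    using assms by (simp add: gaussian_def emeasure_density nn_integral_density)
  also have "\<dots> = (\<integral>\<^sup>+x. \<integral>\<^sup>+y. f x * (ennreal (normal_density (a * x) \<beta> y) * indicator A y) \<partial>lborel \<partial>lborel)"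
    by (intro nn_integral_cong nn_integral_cmult[symmetric]) measurable
  also have "\<dots> = (\<integral>\<^sup>+y. \<integral>\<^sup>+x. f x * (ennreal (normal_density (a * x) \<beta> y) * indicator A y) \<partial>lborel \<partial>lborel)"
    by (rule lborel_pair.Fubini') measurable
  also have "\<dots> = (\<integral>\<^sup>+y. (\<integral>\<^sup>+x. f x * ennreal (normal_density (a * x) \<beta> y) \<partial>lborel) * indicator A y \<partial>lborel)"
    by (simp add: nn_integral_multc flip: mult.assoc)
  also have "\<dots> = emeasure (density lborel (\<lambda>y. \<integral>\<^sup>+x. f x * ennreal (normal_density (a * x) \<beta> y) \<partial>lborel)) A"
    by (simp add: emeasure_density)
  finally show "emeasure (psi a \<beta> (density lborel f)) A =
    emeasure (density lborel (\<lambda>y. \<integral>\<^sup>+x. f x * ennreal (normal_density (a * x) \<beta> y) \<partial>lborel)) A" .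
qed

section \<open>The mixture formulas and the total weight\<close>

text \<open>Gives the density to which both \<open>psi\<close> and \<open>marginal\<close> are
  compared.\<close>

lemma tau_mixture:
  fixes a :: real
  assumes "v > 0" "\<beta> > 0"
  shows "mixture {0..i} (alpha_bar a (\<beta>\<^sup>2) i (\<mu>, m, v)) (\<lambda>k. nu k (tau a (\<beta>\<^sup>2) (\<mu>, m, v))) =
    density lborel (\<lambda>y. ennreal
      (\<Sum>k\<le>i. alpha_bar a (\<beta>\<^sup>2) i (\<mu>, m, v) k * nu_density k (tau a (\<beta>\<^sup>2) (\<mu>, m, v)) y))"
proof -
  have V: "\<beta>\<^sup>2 + a\<^sup>2 * v > 0" using assms by (simp add: add_pos_nonneg)
  show ?thesis
    unfolding atLeast0AtMost
    by (rule mixture_density)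
      (use V assms in \<open>simp_all add: nu_eq_density nu_density_nonneg alpha_bar_nonneg
        del: nu_density.simps\<close>)
qed

text \<open>\<open>psi_density\<close> calls for a nonnegative integral; as the integrand is
  nonnegative and integrable, it equals the Bochner integral already computed.\<close>

lemma psi_nu:
  fixes a :: real
  assumes "v > 0" "\<beta> > 0" "a \<noteq> 0 \<or> i = 0"
  shows "psi a \<beta> (nu i (\<mu>, m, v)) =
    mixture {0..i} (alpha_bar a (\<beta>\<^sup>2) i (\<mu>, m, v)) (\<lambda>k. nu k (tau a (\<beta>\<^sup>2) (\<mu>, m, v)))"
proof -
  have "(\<integral>\<^sup>+x. ennreal (nu_density i (\<mu>, m, v) x) * ennreal (normal_density (a * x) \<beta> y) \<partial>lborel) =
    ennreal (\<Sum>k\<le>i. alpha_bar a (\<beta>\<^sup>2) i (\<mu>, m, v) k * nu_density k (tau a (\<beta>\<^sup>2) (\<mu>, m, v)) y)" for y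
  proof -
    have "(\<integral>\<^sup>+x. ennreal (nu_density i (\<mu>, m, v) x * normal_density (a * x) \<beta> y) \<partial>lborel) =
      ennreal (\<integral>x. nu_density i (\<mu>, m, v) x * normal_density (a * x) \<beta> y \<partial>lborel)"
      using nu_density_conv_mixture[OF assms, of \<mu> m y] nu_density_nonneg[OF assms(1)]
      by (intro nn_integral_eq_integral) (auto simp: has_bochner_integral_iff simp del: nu_density.simps)
    then show ?thesis
      using has_bochner_integral_integral_eq[OF nu_density_conv_mixture[OF assms, of \<mu> m y]]
        nu_density_nonneg[OF assms(1)]
      by (simp add: ennreal_mult del: nu_density.simps tau.simps)
  qed
  then show ?thesis
    using assms
    by (simp add: tau_mixture nu_eq_density psi_density
        del: nu_density.simps tau.simps)
qed

text \<open>The marginal density is that same Bochner integral with (h, \<gamma>) in the role of (a,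
  \<beta>).\<close>

lemma marginal_nu:
  fixes h :: real
  assumes "v > 0" "\<gamma> > 0" "h \<noteq> 0 \<or> i = 0"
  shows "marginal h \<gamma> (nu i (\<mu>, m, v)) =
    mixture {0..i} (alpha_bar h (\<gamma>\<^sup>2) i (\<mu>, m, v)) (\<lambda>k. nu k (tau h (\<gamma>\<^sup>2) (\<mu>, m, v)))"
proof -
  have "marginal_density h \<gamma> (nu i (\<mu>, m, v)) y =
    (\<Sum>k\<le>i. alpha_bar h (\<gamma>\<^sup>2) i (\<mu>, m, v) k * nu_density k (tau h (\<gamma>\<^sup>2) (\<mu>, m, v)) y)" for y
    unfolding marginal_density_def nu_eq_density[OF assms(1)]
    using has_bochner_integral_integral_eq[OF nu_density_conv_mixture[OF assms, of \<mu> m y]]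
      nu_density_nonneg[OF assms(1)]
    by (subst integral_density)
      (auto simp: normal_density_def simp del: nu_density.simps tau.simps)
  then show ?thesis
    unfolding marginal_def using assms
    by (simp add: tau_mixture del: nu_density.simps tau.simps)
qed

lemma sum_alpha_bar:
  fixes a :: real
  assumes "v > 0" "\<beta> > 0" "a \<noteq> 0 \<or> i = 0"
  shows "(\<Sum>k\<le>i. alpha_bar a (\<beta>\<^sup>2) i (\<mu>, m, v) k) = 1"
proof -
  let ?\<alpha> = "alpha_bar a (\<beta>\<^sup>2) i (\<mu>, m, v)" and ?\<theta> = "tau a (\<beta>\<^sup>2) (\<mu>, m, v)"
  have V: "\<beta>\<^sup>2 + a\<^sup>2 * v > 0" using assms by (simp add: add_pos_nonneg)
  have "nu i (\<mu>, m, v) \<in> space (prob_algebra borel)"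
    using prob_space_nu[OF assms(1)] assms(1)
    by (auto simp: space_prob_algebra nu_eq_density simp del: nu_density.simps)
  then have "prob_space (psi a \<beta> (nu i (\<mu>, m, v)))" "sets (psi a \<beta> (nu i (\<mu>, m, v))) = sets borel"
    unfolding psi_def using gaussian_kernel[OF assms(2)] by (rule prob_space_bind', rule sets_bind')
  \<comment> \<open>Comparing total masses replaces an algebraic evaluation of the double
    sum.\<close>
  then have "1 = emeasure (psi a \<beta> (nu i (\<mu>, m, v))) UNIV"
    using prob_space.emeasure_space_1[of "psi a \<beta> (nu i (\<mu>, m, v))"]
      sets_eq_imp_space_eq[of "psi a \<beta> (nu i (\<mu>, m, v))" borel] by simp
  also have "\<dots> = (\<Sum>k\<le>i. ennreal (?\<alpha> k) * emeasure (nu k ?\<theta>) UNIV)"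
    unfolding psi_nu[OF assms] tau_mixture[OF assms(1,2)]
    by (rule emeasure_density_sum)
      (use V assms in \<open>simp_all add: nu_eq_density nu_density_nonneg alpha_bar_nonneg del: nu_density.simps\<close>)
  also have "\<dots> = (\<Sum>k\<le>i. ennreal (?\<alpha> k))"
  proof (intro sum.cong refl)
    fix k
    show "ennreal (?\<alpha> k) * emeasure (nu k ?\<theta>) UNIV = ennreal (?\<alpha> k)"
      using prob_space.emeasure_space_1[OF prob_space_nu[OF V, of k]] V
      by (simp add: nu_eq_density del: nu_density.simps)
  qed
  also have "\<dots> = ennreal (\<Sum>k\<le>i. ?\<alpha> k)"
    using assms by (intro sum_ennreal) (simp add: alpha_bar_nonneg)
  finally show ?thesis by (metis ennreal_eq_1)
qed

section \<open>Condition (C2-f)\<close>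

text \<open>Condition (C2-f) mixes over all k; padding the weights by zeros links it to the finite
  mixture.\<close>

lemma mixture_UNIV:
  "mixture UNIV (\<lambda>k. if k \<le> i then \<alpha> k else 0) N = mixture {0..i} \<alpha> N"
proof -
  have "(\<Sum>\<^sub>\<infinity>k\<in>UNIV. ennreal (if k \<le> i then \<alpha> k else 0) * emeasure (N k) A) =
    (\<Sum>\<^sub>\<infinity>k\<in>{0..i}. ennreal (\<alpha> k) * emeasure (N k) A)" for A
    by (rule infsum_cong_neutral) auto
  then show ?thesis by (simp only: mixture_def)
qed

lemma cond_C2f_psi:
  fixes a \<beta> :: real
  assumes "\<beta> > 0" "a \<noteq> 0"
  shows "cond_C2f (psi a \<beta>) param_space nu (tau a (\<beta>\<^sup>2))
    (\<lambda>i \<theta> k. if k \<le> i then alpha_bar a (\<beta>\<^sup>2) i \<theta> k else 0) (\<lambda>i. i)"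
  unfolding cond_C2f_def
proof (intro conjI allI ballI)
  fix i and \<theta> :: param assume "\<theta> \<in> space param_space"
  then obtain \<mu> m v where \<theta>: "\<theta> = (\<mu>, m, v)" and v: "v > 0"
    by (auto simp: param_space_def space_restrict_space)
  let ?\<alpha> = "\<lambda>k. if k \<le> i then alpha_bar a (\<beta>\<^sup>2) i \<theta> k else 0"
  show "psi a \<beta> (nu i \<theta>) = mixture UNIV ?\<alpha> (\<lambda>k. nu k (tau a (\<beta>\<^sup>2) \<theta>))"
    unfolding \<theta> mixture_UNIV by (rule psi_nu) (use v assms in auto)
  show "tau a (\<beta>\<^sup>2) \<theta> \<in> space param_space"
    using v assms by (simp add: \<theta> param_space_def space_restrict_space add_pos_nonneg)
  show "?\<alpha> k \<ge> 0" for k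
    using v by (simp add: \<theta> alpha_bar_nonneg)
  have "?\<alpha> sums (\<Sum>k\<le>i. ?\<alpha> k)" by (rule sums_finite) auto
  then show "?\<alpha> sums 1"
    using sum_alpha_bar[OF v assms(1), of a i] assms by (simp add: \<theta>)
  \<comment> \<open>The top weight is positive, so the supremum is attained at \<open>i\<close>; the
    zeros beyond \<open>i\<close> give the upper bound.\<close>
  have "?\<alpha> i > 0" using alpha_bar_self_pos[OF v, of "\<beta>\<^sup>2" a] assms by (simp add: \<theta>)
  then show "(SUP k\<in>{k. ?\<alpha> k > 0}. enat k) = enat i"
    by (intro antisym SUP_least SUP_upper) (auto split: if_splits)
next
  fix i
  have [measurable]: "fst \<in> param_space \<rightarrow>\<^sub>M borel" "(\<lambda>\<theta>. fst (snd \<theta>)) \<in> param_space \<rightarrow>\<^sub>M borel"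
    "(\<lambda>\<theta>. snd (snd \<theta>)) \<in> param_space \<rightarrow>\<^sub>M borel"
    unfolding param_space_def by (auto intro!: measurable_restrict_space1 simp flip: borel_prod)
  \<comment> \<open>Measurability is shown first into the product Borel space, with the triple taken
    apart by projections; positivity of the new variance then allows the target to be
    restricted.\<close>
  have "tau a (\<beta>\<^sup>2) \<in> param_space \<rightarrow>\<^sub>M param_space"
  proof -
    have "(\<lambda>\<theta>. ((fst (snd \<theta>) * \<beta>\<^sup>2 + fst \<theta> * (\<beta>\<^sup>2 + a\<^sup>2 * snd (snd \<theta>))) / (a * snd (snd \<theta>)),
        a * fst (snd \<theta>), \<beta>\<^sup>2 + a\<^sup>2 * snd (snd \<theta>))) \<in> param_space \<rightarrow>\<^sub>M borel \<Otimes>\<^sub>M borel \<Otimes>\<^sub>M borel"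
      by measurable
    also have "(\<lambda>\<theta>. ((fst (snd \<theta>) * \<beta>\<^sup>2 + fst \<theta> * (\<beta>\<^sup>2 + a\<^sup>2 * snd (snd \<theta>))) / (a * snd (snd \<theta>)),
        a * fst (snd \<theta>), \<beta>\<^sup>2 + a\<^sup>2 * snd (snd \<theta>))) = tau a (\<beta>\<^sup>2)"
      by (auto simp: fun_eq_iff)
    finally have "tau a (\<beta>\<^sup>2) \<in> param_space \<rightarrow>\<^sub>M borel" by (simp add: borel_prod)
    then show ?thesis
      using assms by (subst (2) param_space_def, intro measurable_restrict_space2)
        (auto simp: param_space_def space_restrict_space add_pos_nonneg)
  qed
  moreover have "(\<lambda>\<theta>. alpha_bar a (\<beta>\<^sup>2) i \<theta> k) \<in> borel_measurable param_space" for k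
  proof -
    \<comment> \<open>Pattern matching on triples is replaced by projections, whose measurability is
      available.\<close>
    have B: "B_const i = (\<lambda>\<theta>. \<Sum>k=0..i. real (i choose k) *
        ((fst \<theta> + fst (snd \<theta>)) ^ (2 * k) / (even_moment k * snd (snd \<theta>) ^ k)))"
      by (auto simp: fun_eq_iff B_const.simps)
    have "(\<lambda>\<theta>. alpha_bar a (\<beta>\<^sup>2) i (fst \<theta>, fst (snd \<theta>), snd (snd \<theta>)) k) \<in> borel_measurable param_space"
      unfolding alpha_bar.simps B by measurable
    then show ?thesis by simp
  qed
  then have "(\<lambda>\<theta> k. if k \<le> i then alpha_bar a (\<beta>\<^sup>2) i \<theta> k else 0) \<in> param_space \<rightarrow>\<^sub>M (\<Pi>\<^sub>M k\<in>UNIV. borel)"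
    by (intro measurable_PiM_single') auto
  ultimately show "(\<lambda>\<theta>. (tau a (\<beta>\<^sup>2) \<theta>, \<lambda>k. if k \<le> i then alpha_bar a (\<beta>\<^sup>2) i \<theta> k else 0)) \<in>
    param_space \<rightarrow>\<^sub>M param_space \<Otimes>\<^sub>M (\<Pi>\<^sub>M k\<in>UNIV. borel)"
    by (rule measurable_Pair)
qed (simp add: mono_def)

text \<open>For \<open>i > 0\<close> the updated shift requires a nonzero coefficient; Condition
  (C2-f) involves every \<open>i\<close> at once, hence the restriction to
  \<open>a \<noteq> 0\<close> there.\<close>

theorem proposition3p2:
  fixes a h \<beta> \<gamma> :: real
  assumes "\<beta> > 0" and "\<gamma> > 0"
  shows
    "((\<forall>i \<mu> m v. v > 0 \<and> (a \<noteq> 0 \<or> i = 0) \<longrightarrow>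
         psi a \<beta> (nu i (\<mu>, m, v)) =
           mixture {0..i} (alpha_bar a (\<beta>\<^sup>2) i (\<mu>, m, v)) (\<lambda>k. nu k (tau a (\<beta>\<^sup>2) (\<mu>, m, v))) \<and>
         (\<forall>k\<in>{0..i}. alpha_bar a (\<beta>\<^sup>2) i (\<mu>, m, v) k \<ge> 0) \<and>
         (\<Sum>k=0..i. alpha_bar a (\<beta>\<^sup>2) i (\<mu>, m, v) k) = 1) \<and>
      (a \<noteq> 0 \<longrightarrow>
         cond_C2f (psi a \<beta>) param_space nu (tau a (\<beta>\<^sup>2))
           (\<lambda>i \<theta> k. if k \<le> i then alpha_bar a (\<beta>\<^sup>2) i \<theta> k else 0) (\<lambda>i. i)))
     \<and>
     (\<forall>i \<mu> m v. v > 0 \<and> (h \<noteq> 0 \<or> i = 0) \<longrightarrow>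
         marginal h \<gamma> (nu i (\<mu>, m, v)) =
           mixture {0..i} (alpha_bar h (\<gamma>\<^sup>2) i (\<mu>, m, v)) (\<lambda>k. nu k (tau h (\<gamma>\<^sup>2) (\<mu>, m, v))) \<and>
         (\<forall>k\<in>{0..i}. alpha_bar h (\<gamma>\<^sup>2) i (\<mu>, m, v) k \<ge> 0) \<and>
         (\<Sum>k=0..i. alpha_bar h (\<gamma>\<^sup>2) i (\<mu>, m, v) k) = 1)"
  using assms
  by (auto simp: psi_nu marginal_nu alpha_bar_nonneg sum_alpha_bar atLeast0AtMost cond_C2f_psi
      simp del: tau.simps)

end
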